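(* Let $q$ be a prime power, $R=\mathbb{F}_q+u\mathbb{F}_q=\mathbb{F}_q[u]/(u^2)$, and let $\mathcal{C}$ be a self-orthogonal linear code of length $n$ over $R$ of type $\{k_1,k_2\}$ with $k_1>0$. Then for every integer $n_0$ satisfying $n-k_1\le n_0<n$, there is a linear code $\mathcal{C}_0$ over $R$ of length $n_0$ whose shortest self-orthogonal embedding is $\mathcal{C}$ (that is, $\mathcal{C}$ is a shortest self-orthogonal embedding of $\mathcal{C}_0$).
   Context: A linear code $\mathcal{C}$ of length $n$ over $R$ is an $R$-submodule of $R^n$. A generator matrix $G$ of $\mathcal{C}$ is a matrix whose rows $\mathbf{c}_1,\dots,\mathbf{c}_{k_1}\in R^n\setminus(uR)^n$ and $\mathbf{c}_{k_1+1},\dots,\mathbf{c}_{k_1+k_2}\in(uR)^n$ are codewords such that every codeword has a unique representation $\sum_{i=1}^{k_1}a_i\mathbf{c}_i+\sum_{j=k_1+1}^{k_1+k_2}b_j\mathbf{c}_j$ with $a_i\in R$, $b_j\in\mathbb{F}_q$; then $\mathcal{C}$ is said to be of type $\{k_1,k_2\}$ and $k_1$ is its free rank. A code over $R$ is self-orthogonal if $\mathbf{x}\cdot\mathbf{y}=0$ (standard dot product) for all its codewords $\mathbf{x},\mathbf{y}$. Given a linear code $\mathcal{D}$ over $R$ with generator matrix $G$, a self-orthogonal embedding of $\mathcal{D}$ is a self-orthogonal code over $R$ generated by the rows of $[G\mid B]$ for some matrix $B$ over $R$. A shortest self-orthogonal embedding of $\mathcal{D}$ is a self-orthogonal embedding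 of $\mathcal{D}$ whose length is smallest among all self-orthogonal embeddings of $\mathcal{D}$.
   Formalization: The claim is proved for C up to a permutation of its coordinates: some coordinate permutation of C is a shortest self-orthogonal embedding of C_0. With C fixed and B appended on the right it fails, e.g. for C = <(1,1,0,0,0,0),(0,0,1,1,0,0)>, q=2, n_0=4. *)

theory Defs
  imports "Jordan_Normal_Form.VS_Connect" "HOL-Combinatorics.Permutations"
begin

text \<open>The ring \<open>F + uF\<close> with \<open>u\<^sup>2 = 0\<close>; \<open>Dual a b\<close> stands for \<open>a + ub\<close>.
  For \<open>F\<close> a finite field with \<open>q\<close> elements this is \<open>R\<close>. The lemmas about \<open>dual_of_poly\<close> below
  identify it with \<open>F[u]/(u\<^sup>2)\<close>.\<close>

datatype 'a dual = Dual (dual_re: 'a) (dual_nil: 'a)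

instantiation dual :: (comm_ring_1) comm_ring_1
begin

definition zero_dual :: "'a dual" where
  "0 = Dual 0 0"

definition one_dual :: "'a dual" where
  "1 = Dual 1 0"

definition plus_dual :: "'a dual \<Rightarrow> 'a dual \<Rightarrow> 'a dual" where
  "x + y = Dual (dual_re x + dual_re y) (dual_nil x + dual_nil y)"

definition uminus_dual :: "'a dual \<Rightarrow> 'a dual" where
  "- x = Dual (- dual_re x) (- dual_nil x)"

definition minus_dual :: "'a dual \<Rightarrow> 'a dual \<Rightarrow> 'a dual" where
  "x - y = Dual (dual_re x - dual_re y) (dual_nil x - dual_nil y)"

definition times_dual :: "'a dual \<Rightarrow> 'a dual \<Rightarrow> 'a dual" where
  "x * y = Dual (dual_re x * dual_re y) (dual_re x * dual_nil y + dual_nil x * dual_re y)"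

instance
  by standard
    (auto simp: zero_dual_def one_dual_def plus_dual_def uminus_dual_def minus_dual_def
      times_dual_def algebra_simps)

end

definition dual_u :: "'a::comm_ring_1 dual" where
  "dual_u = Dual 0 1"

definition dual_base :: "'a::comm_ring_1 dual set" where
  "dual_base = {Dual a 0 | a. True}"

definition dual_of_poly :: "'a::comm_ring_1 poly \<Rightarrow> 'a dual" where
  "dual_of_poly p = Dual (coeff p 0) (coeff p 1)"

lemma dual_of_poly_hom:
  "dual_of_poly 0 = 0"
  "dual_of_poly 1 = 1"
  "dual_of_poly (p + q) = dual_of_poly p + dual_of_poly q"
  "dual_of_poly (p * q) = dual_of_poly p * dual_of_poly q"
  "dual_of_poly [:0, 1:] = dual_u"
  by (simp_all add: dual_of_poly_def dual_u_def zero_dual_def one_dual_def plus_dual_def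
      times_dual_def coeff_mult)

lemma surj_dual_of_poly: "surj dual_of_poly"
proof (rule surjI)
  show "dual_of_poly [:dual_re x, dual_nil x:] = x" for x :: "'a dual"
    by (simp add: dual_of_poly_def)
qed

lemma dual_of_poly_eq_0_iff: "dual_of_poly p = 0 \<longleftrightarrow> [:0, 1:] ^ 2 dvd p"
proof
  assume "dual_of_poly p = 0"
  then have c: "coeff p 0 = 0" "coeff p (Suc 0) = 0"
    by (auto simp: dual_of_poly_def zero_dual_def)
  obtain a b r where p: "p = pCons a (pCons b r)"
    by (metis pCons_cases)
  with c have "p = [:0, 1:] ^ 2 * r"
    by (simp add: power2_eq_square)
  then show "[:0, 1:] ^ 2 dvd p" ..
next
  assume "[:0, 1:] ^ 2 dvd p"
  then obtain r where "p = [:0, 1:] ^ 2 * r" ..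
  then show "dual_of_poly p = 0"
    by (simp add: dual_of_poly_def zero_dual_def power2_eq_square)
qed

text \<open>\<open>LinearCombinations.submodule\<close> takes the ring, the subset and the module in this order;
  it is not the homonymous locale of HOL-Algebra.\<close>

definition linear_code :: "nat \<Rightarrow> 'a::comm_ring_1 dual vec set \<Rightarrow> bool" where
  "linear_code n C \<longleftrightarrow>
     LinearCombinations.submodule class_ring C (module_vec TYPE('a dual) n)"

definition self_orthogonal :: "'a::comm_ring_1 dual vec set \<Rightarrow> bool" where
  "self_orthogonal C \<longleftrightarrow> (\<forall>x \<in> C. \<forall>y \<in> C. x \<bullet> y = 0)"

text \<open>The submodule \<open>(uR)\<^sup>n\<close> of \<open>R\<^sup>n\<close>.\<close>

definition u_vecs :: "nat \<Rightarrow> 'a::comm_ring_1 dual vec set" where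
  "u_vecs n = {v \<in> carrier_vec n. \<forall>i<n. dual_u dvd v $ i}"

text \<open>The vector \<open>c\<close> collects the coefficients \<open>a\<^sub>1, \<dots>, b\<^sub>1, \<dots>\<close> of a combination of the rows,
  so the combination itself is \<open>G\<^sup>T *\<^sub>v c\<close>.\<close>

definition generator_matrix ::
  "nat \<Rightarrow> nat \<Rightarrow> nat \<Rightarrow> 'a::comm_ring_1 dual vec set \<Rightarrow> 'a dual mat \<Rightarrow> bool" where
  "generator_matrix n k1 k2 C G \<longleftrightarrow>
     G \<in> carrier_mat (k1 + k2) n \<and>
     (\<forall>i < k1 + k2. row G i \<in> C) \<and>
     (\<forall>i < k1. row G i \<notin> u_vecs n) \<and>
     (\<forall>i \<in> {k1..<k1 + k2}. row G i \<in> u_vecs n) \<and>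
     (\<forall>x \<in> C. \<exists>!c. c \<in> carrier_vec (k1 + k2) \<and>
        (\<forall>i \<in> {k1..<k1 + k2}. c $ i \<in> dual_base) \<and> x = G\<^sup>T *\<^sub>v c)"

definition code_type :: "nat \<Rightarrow> 'a::comm_ring_1 dual vec set \<Rightarrow> nat \<Rightarrow> nat \<Rightarrow> bool" where
  "code_type n C k1 k2 \<longleftrightarrow> (\<exists>G. generator_matrix n k1 k2 C G)"

text \<open>The block matrix \<open>[G | B]\<close>, for \<open>G\<close> and \<open>B\<close> with equally many rows.\<close>

definition append_cols :: "'a::zero mat \<Rightarrow> 'a mat \<Rightarrow> 'a mat" where
  "append_cols G B = four_block_mat G B (0\<^sub>m 0 (dim_col G)) (0\<^sub>m 0 (dim_col B))"

definition code_generated_by_rows :: "'a::comm_ring_1 dual mat \<Rightarrow> 'a dual vec set" where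
  "code_generated_by_rows A =
     LinearCombinations.module.span class_ring (module_vec TYPE('a dual) (dim_col A)) (set (rows A))"

text \<open>\<open>so_embedding n D m E\<close>: the code \<open>E\<close> of length \<open>m\<close> is a self-orthogonal embedding of the
  code \<open>D\<close> of length \<open>n\<close>. Two generator matrices of \<open>D\<close> differ by an invertible row transformation
  over \<open>R\<close>, which can be absorbed into \<open>B\<close>; so the choice of \<open>G\<close> is immaterial. \<open>B\<close> may have no
  columns.\<close>

definition so_embedding ::
  "nat \<Rightarrow> 'a::comm_ring_1 dual vec set \<Rightarrow> nat \<Rightarrow> 'a dual vec set \<Rightarrow> bool" where
  "so_embedding n D m E \<longleftrightarrow>
     (\<exists>k1 k2 l G B. generator_matrix n k1 k2 D G \<and> B \<in> carrier_mat (k1 + k2) l \<and> m = n + l \<and>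
        E = code_generated_by_rows (append_cols G B) \<and> self_orthogonal E)"

definition shortest_so_embedding ::
  "nat \<Rightarrow> 'a::comm_ring_1 dual vec set \<Rightarrow> nat \<Rightarrow> 'a dual vec set \<Rightarrow> bool" where
  "shortest_so_embedding n D m E \<longleftrightarrow>
     so_embedding n D m E \<and> (\<forall>m' E'. so_embedding n D m' E' \<longrightarrow> m \<le> m')"

text \<open>Codes are considered up to a permutation of the coordinates. Embeddings append columns on the
  right, so this is needed to let the appended columns be arbitrary coordinates of a given code
  (whose last coordinates may all vanish, for instance).\<close>

definition permute_code :: "nat \<Rightarrow> (nat \<Rightarrow> nat) \<Rightarrow> 'b vec set \<Rightarrow> 'b vec set" where
  "permute_code n \<pi> C = (\<lambda>x. vec n (\<lambda>i. x $ \<pi> i)) ` C"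

end

theory Submission
  imports Defs
begin

text \<open>Puncture \<open>C\<close> at \<open>r = n - n\<^sub>0 \<le> k\<^sub>1\<close> coordinates on which it projects onto all of \<open>R\<^sup>r\<close>.
  A codeword vanishing at the remaining coordinates is orthogonal to all of \<open>R\<^sup>r\<close>, hence zero; so
  puncturing is injective and \<open>C\<close> embeds the punctured code. Conversely, choose codewords of \<open>C\<close>
  whose deleted parts are the unit vectors of \<open>R\<^sup>r\<close>: their punctured parts have Gram matrix \<open>- I\<close>,
  so in any self-orthogonal embedding the appended parts have Gram matrix \<open>I\<close>, which takes at
  least \<open>r\<close> columns.\<close>

section \<open>Arithmetic of dual numbers\<close>

lemma dual_sel_simps [simp]:
  "dual_re (0 :: 'a::comm_ring_1 dual) = 0" "dual_nil (0 :: 'a dual) = 0"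
  "dual_re (1 :: 'a dual) = 1" "dual_nil (1 :: 'a dual) = 0"
  "dual_re (dual_u :: 'a dual) = 0" "dual_nil (dual_u :: 'a dual) = 1"
  by (simp_all add: zero_dual_def one_dual_def dual_u_def)

lemma dual_sel_ring_simps [simp]:
  fixes x y :: "'a::comm_ring_1 dual"
  shows "dual_re (x + y) = dual_re x + dual_re y" "dual_nil (x + y) = dual_nil x + dual_nil y"
    "dual_re (x - y) = dual_re x - dual_re y" "dual_nil (x - y) = dual_nil x - dual_nil y"
    "dual_re (- x) = - dual_re x" "dual_nil (- x) = - dual_nil x"
    "dual_re (x * y) = dual_re x * dual_re y"
    "dual_nil (x * y) = dual_re x * dual_nil y + dual_nil x * dual_re y"
  by (simp_all add: plus_dual_def minus_dual_def uminus_dual_def times_dual_def)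

lemma dual_re_sum: "dual_re (\<Sum>i\<in>A. f i) = (\<Sum>i\<in>A. dual_re (f i))"
  for f :: "'b \<Rightarrow> 'a::comm_ring_1 dual"
  by (induction A rule: infinite_finite_induct) simp_all

lemma dual_u_dvd_iff: "dual_u dvd x \<longleftrightarrow> dual_re x = 0" for x :: "'a::comm_ring_1 dual"
proof
  assume "dual_re x = 0"
  then have "x = dual_u * Dual (dual_nil x) 0"
    by (intro dual.expand) simp
  then show "dual_u dvd x" ..
qed auto

lemma dual_u_mult_eq_0_iff: "dual_u * x = 0 \<longleftrightarrow> dual_re x = 0" for x :: "'a::comm_ring_1 dual"
  by (auto simp: dual.expand dest: arg_cong[where f = dual_nil] intro!: dual.expand)

lemma dual_unit: "\<exists>y. x * y = 1" if "dual_re x \<noteq> 0" for x :: "'a::field dual"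
proof -
  \<comment> \<open>Since (a + ub)(a - ub) = a^2, the inverse of a + ub is (a - ub) / a^2.\<close>
  have "x * Dual (1 / dual_re x) (- dual_nil x / (dual_re x)\<^sup>2) = 1"
    using that by (intro dual.expand) (simp add: field_simps power2_eq_square)
  then show ?thesis ..
qed

section \<open>Linear codes, row combinations and generator matrices\<close>

lemma linear_code_iff:
  fixes C :: "'a::comm_ring_1 dual vec set"
  shows "linear_code n C \<longleftrightarrow> C \<subseteq> carrier_vec n \<and> 0\<^sub>v n \<in> C \<and>
    (\<forall>x\<in>C. \<forall>y\<in>C. x + y \<in> C) \<and> (\<forall>a. \<forall>x\<in>C. a \<cdot>\<^sub>v x \<in> C)"
proof -
  interpret vec_module "TYPE('a dual)" n .
  show ?thesis
    unfolding linear_code_def LinearCombinations.submodule_def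
    using module_axioms by (auto simp: module_vec_simps)
qed

lemma linear_code_sum:
  fixes C :: "'a::comm_ring_1 dual vec set" and k :: nat
  assumes "linear_code n C" and "\<And>i. i < k \<Longrightarrow> f i \<in> C"
  shows "vec n (\<lambda>j. \<Sum>i<k. c i * f i $ j) \<in> C"
  using assms(2)
proof (induction k)
  case 0
  then show ?case
    using assms(1) by (simp add: linear_code_iff zero_vec_def)
next
  case (Suc k)
  have "f k \<in> carrier_vec n"
    using assms(1) Suc.prems by (auto simp: linear_code_iff)
  then have "vec n (\<lambda>j. \<Sum>i<Suc k. c i * f i $ j) = vec n (\<lambda>j. \<Sum>i<k. c i * f i $ j) + c k \<cdot>\<^sub>v f k"
    by auto
  then show ?case
    using Suc assms(1) by (simp add: linear_code_iff)
qed

lemma transpose_mult_vec_eq: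
  fixes G :: "'a::comm_semiring_0 mat"
  assumes "G \<in> carrier_mat k n" "c \<in> carrier_vec k"
  shows "G\<^sup>T *\<^sub>v c = vec n (\<lambda>j. \<Sum>i<k. c $ i * row G i $ j)"
  using assms by (auto simp: scalar_prod_def mult.commute atLeast0LessThan intro!: eq_vecI sum.cong)

lemma linear_code_transpose_mult_vec:
  assumes "linear_code n C" "G \<in> carrier_mat k n" "c \<in> carrier_vec k"
    and "\<And>i. i < k \<Longrightarrow> row G i \<in> C"
  shows "G\<^sup>T *\<^sub>v c \<in> C"
  unfolding transpose_mult_vec_eq[OF assms(2,3)] using assms by (intro linear_code_sum)

lemma linear_code_generated:
  "linear_code (dim_col G) (code_generated_by_rows G)"
  "i < dim_row G \<Longrightarrow> row G i \<in> code_generated_by_rows G"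
proof -
  interpret vec_module "TYPE('a dual)" "dim_col G" .
  have "set (rows G) \<subseteq> carrier_vec (dim_col G)"
    by (auto simp: rows_def)
  then show "linear_code (dim_col G) (code_generated_by_rows G)"
    "i < dim_row G \<Longrightarrow> row G i \<in> code_generated_by_rows G"
    using in_own_span[of "set (rows G)"] span_is_submodule[of "set (rows G)"]
    by (auto simp: linear_code_def code_generated_by_rows_def module_vec_simps rows_def)
qed

text \<open>Links the two descriptions of a code in use: embeddings are spans of rows, while the
  type of a code refers to combinations with restricted coefficients.\<close>

lemma code_generated_by_generator_matrix:
  assumes "linear_code n C" "generator_matrix n k1 k2 C G"
  shows "code_generated_by_rows G = C"
proof
  interpret vec_module "TYPE('a dual)" n .
  have G: "G \<in> carrier_mat (k1 + k2) n" "\<And>i. i < k1 + k2 \<Longrightarrow> row G i \<in> C"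
    using assms(2) by (auto simp: generator_matrix_def)
  then have "set (rows G) \<subseteq> C"
    by (auto simp: rows_def)
  then show "code_generated_by_rows G \<subseteq> C"
    using G assms(1) span_is_subset[of "set (rows G)" C]
    by (auto simp: linear_code_def code_generated_by_rows_def)
  show "C \<subseteq> code_generated_by_rows G"
  proof
    fix x assume "x \<in> C"
    then obtain c where "c \<in> carrier_vec (k1 + k2)" "x = G\<^sup>T *\<^sub>v c"
      using assms(2) unfolding generator_matrix_def by blast
    then show "x \<in> code_generated_by_rows G"
      using G(1) linear_code_generated[where G = G]
      by (auto intro!: linear_code_transpose_mult_vec)
  qed
qed

section \<open>Information sets and the free rank\<close>

text \<open>Counting stands in for a dimension argument: an injection from F^A to F^B gives q^|A| <=
  q^|B|, and q >= 2 lets the exponents be compared.\<close>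

lemma card_le_if_inj_on_funcset:
  assumes "finite A" "finite B"
    and "inj_on \<Phi> (A \<rightarrow>\<^sub>E (UNIV :: 'a::{field, finite} set))"
    and "\<And>a. a \<in> A \<rightarrow>\<^sub>E UNIV \<Longrightarrow> \<Phi> a \<in> B \<rightarrow>\<^sub>E (UNIV :: 'a set)"
  shows "card A \<le> card B"
proof -
  have "card (A \<rightarrow>\<^sub>E (UNIV :: 'a set)) \<le> card (B \<rightarrow>\<^sub>E (UNIV :: 'a set))"
    using assms by (intro card_inj_on_le[of \<Phi>] finite_PiE) auto
  then have "card (UNIV :: 'a set) ^ card A \<le> card (UNIV :: 'a set) ^ card B"
    using assms by (simp add: card_PiE)
  moreover have "1 < card (UNIV :: 'a set)"
    using card_mono[of UNIV "{0, 1 :: 'a}"] by simp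
  ultimately show ?thesis
    by simp
qed

text \<open>The projection of \<open>C\<close> to the coordinates in \<open>J\<close> is onto;
  unlike in the common use of the term, it may fail to be injective.\<close>

definition information_set :: "nat set \<Rightarrow> 'a::comm_ring_1 dual vec set \<Rightarrow> bool" where
  "information_set J C \<longleftrightarrow> (\<forall>f. \<exists>x\<in>C. \<forall>j\<in>J. x $ j = f j)"

lemma information_set_subset:
  assumes "information_set J C" "J' \<subseteq> J"
  shows "information_set J' C"
  using assms unfolding information_set_def by blast

text \<open>A codeword that vanishes on \<open>J\<close> and has a unit at \<open>i\<close> would
  allow \<open>i\<close> to be added to \<open>J\<close>, against maximality. A codeword whose
  residues vanish on \<open>J\<close> reduces to this case by subtracting a multiple of u, which
  leaves all residues unchanged.\<close>

lemma maximal_information_set_re: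
  fixes C :: "'a::field dual vec set"
  assumes C: "linear_code n C" and J: "J \<subseteq> {..<n}" "information_set J C"
    and max: "\<And>J'. J' \<subseteq> {..<n} \<Longrightarrow> information_set J' C \<Longrightarrow> J \<subseteq> J' \<Longrightarrow> J' = J"
    and x: "x \<in> C" "\<And>j. j \<in> J \<Longrightarrow> dual_re (x $ j) = 0" and "i < n"
  shows "dual_re (x $ i) = 0"
proof -
  have cl: "y \<in> carrier_vec n" "a \<cdot>\<^sub>v y \<in> C" "y + z \<in> C" if "y \<in> C" "z \<in> C" for a y z
    using C that by (auto simp: linear_code_iff)
  have zero: "dual_re (w $ i) = 0" if w: "w \<in> C" "\<And>j. j \<in> J \<Longrightarrow> w $ j = 0" for w
  proof (rule ccontr)
    assume nz: "dual_re (w $ i) \<noteq> 0"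
    then obtain e where e: "w $ i * e = 1"
      using dual_unit by blast
    have "information_set (insert i J) C"
      unfolding information_set_def
    proof
      fix f
      obtain y where y: "y \<in> C" "\<forall>j\<in>J. y $ j = f j"
        using J(2) unfolding information_set_def by blast
      \<comment> \<open>Adding a multiple of \<open>w\<close> changes nothing on \<open>J\<close>,
        and as \<open>e\<close> inverts \<open>w $ i\<close>, this multiple corrects coordinate
        \<open>i\<close> to \<open>f i\<close>.\<close>
      let ?z = "y + ((f i - y $ i) * e) \<cdot>\<^sub>v w"
      have "?z $ j = f j" if "j \<in> insert i J" for j
      proof (cases "j = i")
        case True
        then show ?thesis
          using cl[OF y(1) w(1)] cl[OF w(1) w(1)] \<open>i < n\<close> e by (simp add: mult.assoc mult.commute[of e])
      next
        case False
        then show ?thesis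
          using that cl[OF y(1) w(1)] cl[OF w(1) w(1)] J(1) y w by auto
      qed
      then show "\<exists>x\<in>C. \<forall>j\<in>insert i J. x $ j = f j"
        using cl y w by (intro bexI[of _ ?z]) auto
    qed
    then have "i \<in> J"
      using max[of "insert i J"] J(1) \<open>i < n\<close> by auto
    then show False
      using w(2) nz by simp
  qed
  \<comment> \<open>On \<open>J\<close> the entries of \<open>x\<close> are u times their nilpotent
    parts, so with this \<open>z\<close> the codeword x - uz vanishes on \<open>J\<close>.\<close>
  obtain z where z: "z \<in> C" "\<forall>j\<in>J. z $ j = Dual (dual_nil (x $ j)) 0"
    using J(2)[unfolded information_set_def, rule_format, of "\<lambda>j. Dual (dual_nil (x $ j)) 0"] by blast
  let ?w = "x + (- dual_u) \<cdot>\<^sub>v z"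
  have "?w $ j = 0" if "j \<in> J" for j
    using that J(1) x(2) z cl[OF z(1) z(1)] by (intro dual.expand) auto
  then have "dual_re (?w $ i) = 0"
    using zero[of ?w] cl x(1) z(1) by blast
  then show ?thesis
    using cl[OF z(1) z(1)] \<open>i < n\<close> by simp
qed

text \<open>For a maximal information set \<open>J\<close>, the residues in \<open>F\<close> of the coordinates in \<open>J\<close> determine
  the residue of a codeword, so \<open>F\<^bsup>k1\<^esup>\<close> embeds into the functions from \<open>J\<close> to \<open>F\<close>.\<close>

lemma information_set_exists:
  fixes C :: "'a::{field, finite} dual vec set"
  assumes C: "linear_code n C" and gen: "generator_matrix n k1 k2 C G" and "r \<le> k1"
  shows "\<exists>J\<subseteq>{..<n}. card J = r \<and> information_set J C"
proof -
  let ?S = "{J. J \<subseteq> {..<n} \<and> information_set J C}"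
  have "finite ?S" "{} \<in> ?S"
    using C by (auto simp: information_set_def linear_code_iff)
  then have "\<exists>J\<in>?S. \<forall>J'\<in>?S. J \<subseteq> J' \<longrightarrow> J = J'"
    by (intro finite_has_maximal) auto
  then obtain J where "J \<in> ?S" "\<forall>J'\<in>?S. J \<subseteq> J' \<longrightarrow> J = J'" ..
  then have J: "J \<subseteq> {..<n}" "information_set J C"
    and max: "\<And>J'. J' \<subseteq> {..<n} \<Longrightarrow> information_set J' C \<Longrightarrow> J \<subseteq> J' \<Longrightarrow> J' = J"
    by auto
  have G: "G \<in> carrier_mat (k1 + k2) n" "\<And>i. i < k1 + k2 \<Longrightarrow> row G i \<in> C"
    using gen by (auto simp: generator_matrix_def)
  define \<Phi> where "\<Phi> a = (\<lambda>j\<in>J. \<Sum>i<k1. a i * dual_re (row G i $ j))" for a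
  have "inj_on \<Phi> ({..<k1} \<rightarrow>\<^sub>E UNIV)"
  proof (rule inj_onI)
    fix a b assume ab: "a \<in> {..<k1} \<rightarrow>\<^sub>E UNIV" "b \<in> {..<k1} \<rightarrow>\<^sub>E UNIV" and eq: "\<Phi> a = \<Phi> b"
    \<comment> \<open>On \<open>J\<close> the residues of \<open>x\<close> are the differences of
      \<open>\<Phi> a\<close> and \<open>\<Phi> b\<close>, hence zero; maximality of
      \<open>J\<close> then makes all residues of \<open>x\<close> vanish.\<close>
    define x where "x = vec n (\<lambda>j. \<Sum>i<k1. Dual (a i - b i) 0 * row G i $ j)"
    have "x \<in> C"
      unfolding x_def using C G(2) by (intro linear_code_sum) auto
    moreover have "dual_re (x $ j) = 0" if "j \<in> J" for j
      using fun_cong[OF eq, of j] that J(1)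
      by (auto simp: x_def \<Phi>_def dual_re_sum left_diff_distrib sum_subtractf)
    ultimately have re: "dual_re (x $ i) = 0" if "i < n" for i
      using maximal_information_set_re[OF C J max] that by blast
    \<comment> \<open>The coefficients of ux, which is zero because the residues of \<open>x\<close>
      vanish. The entries for the rows in (uR)^n are 0 and so lie in \<open>dual_base\<close>;
      uniqueness of the representation of the zero codeword forces \<open>c\<close> to be
      zero.\<close>
    define c where "c = vec (k1 + k2) (\<lambda>i. if i < k1 then Dual 0 (a i - b i) else 0)"
    have "G\<^sup>T *\<^sub>v c = 0\<^sub>v n"
    proof (rule eq_vecI)
      fix j assume "j < dim_vec (0\<^sub>v n :: 'a dual vec)"
      then have j: "j < n" by simp
      have "(G\<^sup>T *\<^sub>v c) $ j = (\<Sum>i<k1 + k2. c $ i * row G i $ j)"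
        using j transpose_mult_vec_eq[OF G(1), of c] by (simp add: c_def)
      also have "\<dots> = (\<Sum>i<k1. dual_u * (Dual (a i - b i) 0 * row G i $ j))"
        by (intro sum.mono_neutral_cong_right) (auto simp: c_def intro!: dual.expand)
      also have "\<dots> = dual_u * x $ j"
        using j by (simp add: x_def sum_distrib_left)
      finally show "(G\<^sup>T *\<^sub>v c) $ j = 0\<^sub>v n $ j"
        using re j by (simp add: dual_u_mult_eq_0_iff)
    qed (use G(1) in simp)
    moreover have "G\<^sup>T *\<^sub>v 0\<^sub>v (k1 + k2) = 0\<^sub>v n"
      using G(1) by (intro eq_vecI) auto
    moreover have "0\<^sub>v n \<in> C"
      using C by (simp add: linear_code_iff)
    moreover have "(0 :: 'a dual) \<in> dual_base"
      by (simp add: dual_base_def zero_dual_def)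
    ultimately have "c = 0\<^sub>v (k1 + k2)"
      using gen unfolding generator_matrix_def c_def
      by (smt (verit) atLeastLessThan_iff index_vec index_zero_vec(1) leD vec_carrier zero_carrier_vec)
    then have "c $ i = 0" if "i < k1" for i
      using that by simp
    then have "a i = b i" if "i < k1" for i
      using that by (fastforce simp: c_def zero_dual_def)
    then show "a = b"
      using ab by (intro PiE_ext) auto
  qed
  then have "card {..<k1} \<le> card J"
    using J(1) by (intro card_le_if_inj_on_funcset[of _ _ \<Phi>]) (auto simp: \<Phi>_def finite_subset)
  then have "r \<le> card J"
    using \<open>r \<le> k1\<close> by simp
  \<comment> \<open>A maximal information set may have more than \<open>r\<close> elements; its
    subsets are information sets too.\<close>
  then obtain J' where "J' \<subseteq> J" "card J' = r"
    by (meson obtain_subset_with_card_n)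
  then show ?thesis
    using J information_set_subset by blast
qed

section \<open>Orthonormal vectors over R\<close>

text \<open>Pairing a combination of the residue vectors with the j-th one recovers its j-th
  coefficient. So forming combinations is an injection from F^r to F^l.\<close>

lemma orthonormal_vecs_le_dim:
  fixes z :: "nat \<Rightarrow> 'a::{field, finite} dual vec"
  assumes "\<And>i. i < r \<Longrightarrow> z i \<in> carrier_vec l"
    and "\<And>i j. i < r \<Longrightarrow> j < r \<Longrightarrow> z i \<bullet> z j = (if i = j then 1 else 0)"
  shows "r \<le> l"
proof -
  define \<Phi> where "\<Phi> a = (\<lambda>t\<in>{..<l}. \<Sum>i<r. a i * dual_re (z i $ t))" for a
  have coeff: "(\<Sum>t<l. \<Phi> a t * dual_re (z j $ t)) = a j" if "j < r" for a j
  proof -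
    have "(\<Sum>t<l. \<Phi> a t * dual_re (z j $ t)) =
        (\<Sum>i<r. \<Sum>t<l. a i * (dual_re (z i $ t) * dual_re (z j $ t)))"
      by (subst sum.swap) (simp add: \<Phi>_def sum_distrib_right mult.assoc)
    also have "\<dots> = (\<Sum>i<r. a i * dual_re (z i \<bullet> z j))"
      using carrier_vecD[OF assms(1)[OF that]]
      by (intro sum.cong) (auto simp: scalar_prod_def dual_re_sum sum_distrib_left atLeast0LessThan)
    also have "\<dots> = (\<Sum>i<r. if i = j then a i else 0)"
      using that by (intro sum.cong) (auto simp: assms(2))
    finally show ?thesis
      using that by simp
  qed
  have "inj_on \<Phi> ({..<r} \<rightarrow>\<^sub>E UNIV)"
  proof (rule inj_onI)
    fix a b :: "nat \<Rightarrow> 'a"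
    assume ab: "a \<in> {..<r} \<rightarrow>\<^sub>E UNIV" "b \<in> {..<r} \<rightarrow>\<^sub>E UNIV" and "\<Phi> a = \<Phi> b"
    then have "a j = b j" if "j < r" for j
      using coeff[OF that, of a] coeff[OF that, of b] by simp
    then show "a = b"
      using ab by (intro PiE_ext) auto
  qed
  then have "card {..<r} \<le> card {..<l}"
    by (intro card_le_if_inj_on_funcset[of _ _ \<Phi>]) (auto simp: \<Phi>_def)
  then show ?thesis by simp
qed

section \<open>Permuting and puncturing coordinates\<close>

text \<open>One operation serves two purposes: for a permutation \<open>\<sigma>\<close> of
  \<open>{..<n}\<close>, \<open>m = n\<close> permutes the coordinates, and \<open>m < n\<close>
  also deletes those that \<open>\<sigma>\<close> places at positions \<open>m\<close> and
  beyond.\<close>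

lemma linear_code_permute_code:
  fixes C :: "'a::comm_ring_1 dual vec set"
  assumes "linear_code n C" "\<sigma> ` {..<m} \<subseteq> {..<n}"
  shows "linear_code m (permute_code m \<sigma> C)"
proof -
  let ?s = "\<lambda>x :: 'a dual vec. vec m (\<lambda>i. x $ \<sigma> i)"
  have s: "\<sigma> i < n" if "i < m" for i
    using assms(2) that by auto
  have C: "dim_vec x = n" "y \<in> C \<Longrightarrow> x + y \<in> C" "a \<cdot>\<^sub>v x \<in> C" "0\<^sub>v n \<in> C" if "x \<in> C" for a x y
    using assms(1) that by (auto simp: linear_code_iff)
  have add: "?s x + ?s y = ?s (x + y)" and smult: "a \<cdot>\<^sub>v ?s x = ?s (a \<cdot>\<^sub>v x)"
    if "x \<in> C" "y \<in> C" for a x y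
    using C(1)[OF that(1)] C(1)[OF that(2)] s by (simp_all add: vec_eq_iff)
  have "0\<^sub>v m = ?s (0\<^sub>v n)"
    using s by (simp add: vec_eq_iff)
  then have "0\<^sub>v m \<in> ?s ` C"
    using assms(1) unfolding linear_code_iff by blast
  moreover have "v + w \<in> ?s ` C" if "v \<in> ?s ` C" "w \<in> ?s ` C" for v w
    using that add C(2) by force
  moreover have "a \<cdot>\<^sub>v v \<in> ?s ` C" if "v \<in> ?s ` C" for a v
    using that smult C(3) by force
  ultimately show ?thesis
    unfolding linear_code_iff permute_code_def by (simp add: image_subset_iff)
qed

text \<open>Selecting coordinates commutes with row combinations, so if it is injective on
  \<open>C\<close>, unique representations carry over with the same coefficients and the type is
  preserved.\<close>

lemma generator_matrix_permute_code:
  fixes C :: "'a::comm_ring_1 dual vec set"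
  assumes C: "linear_code n C" and gen: "generator_matrix n k1 k2 C G"
    and \<sigma>: "\<sigma> ` {..<m} \<subseteq> {..<n}" and inj: "inj_on (\<lambda>x. vec m (\<lambda>i. x $ \<sigma> i)) C"
  shows "generator_matrix m k1 k2 (permute_code m \<sigma> C) (mat (k1 + k2) m (\<lambda>(i, j). G $$ (i, \<sigma> j)))"
    (is "generator_matrix _ _ _ _ ?H")
proof -
  let ?s = "\<lambda>x :: 'a dual vec. vec m (\<lambda>i. x $ \<sigma> i)"
  have s: "\<sigma> i < n" if "i < m" for i
    using \<sigma> that by auto
  have G: "G \<in> carrier_mat (k1 + k2) n" "\<And>i. i < k1 + k2 \<Longrightarrow> row G i \<in> C"
    "\<And>i. i < k1 \<Longrightarrow> row G i \<notin> u_vecs n" "\<And>i. i \<in> {k1..<k1+k2} \<Longrightarrow> row G i \<in> u_vecs n"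
    using gen by (auto simp: generator_matrix_def)
  have row: "row ?H i = ?s (row G i)" if "i < k1 + k2" for i
    using that G(1) s by auto
  have entry: "row G i $ \<sigma> j = G $$ (i, \<sigma> j)" if "i < k1 + k2" "j < m" for i j
    using that G(1) s by simp
  have comb: "?H\<^sup>T *\<^sub>v c = ?s (G\<^sup>T *\<^sub>v c)" if "c \<in> carrier_vec (k1 + k2)" for c
    using that s by (auto simp: transpose_mult_vec_eq[OF G(1) that]
        transpose_mult_vec_eq[of ?H "k1 + k2" m] entry intro!: eq_vecI sum.cong)
  \<comment> \<open>Here injectivity keeps the free rows free: if the image of a row is divisible by
    u, then u times the row is sent to zero, so u times the row is zero and the row itself lies in
    (uR)^n.\<close>
  have not_u: "?s (row G i) \<notin> u_vecs m" if i: "i < k1" for i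
  proof
    assume "?s (row G i) \<in> u_vecs m"
    then have "?s (dual_u \<cdot>\<^sub>v row G i) = ?s (0\<^sub>v n)"
      using i s G(1) by (auto simp: u_vecs_def dual_u_dvd_iff dual_u_mult_eq_0_iff intro!: eq_vecI)
    then have "dual_u \<cdot>\<^sub>v row G i = 0\<^sub>v n"
      by (rule inj_onD[OF inj]) (use C G(2)[of i] i in \<open>simp_all add: linear_code_iff\<close>)
    then have "(dual_u \<cdot>\<^sub>v row G i) $ j = 0" if "j < n" for j
      using that by simp
    then have "dual_u * row G i $ j = 0" if "j < n" for j
      using that G(1) i by fastforce
    then have "row G i \<in> u_vecs n"
      using G(1) i by (auto simp: u_vecs_def dual_u_dvd_iff dual_u_mult_eq_0_iff)
    then show False
      using G(3) i by blast
  qed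
  have ex: "\<exists>!c. c \<in> carrier_vec (k1 + k2) \<and> (\<forall>i\<in>{k1..<k1+k2}. c $ i \<in> dual_base) \<and> ?s x = ?H\<^sup>T *\<^sub>v c"
    if x: "x \<in> C" for x
  proof -
    have "?s x = ?H\<^sup>T *\<^sub>v c \<longleftrightarrow> x = G\<^sup>T *\<^sub>v c" if "c \<in> carrier_vec (k1 + k2)" for c
      using comb[OF that] inj_on_eq_iff[OF inj x linear_code_transpose_mult_vec[OF C G(1) that G(2)]]
      by simp
    moreover have "\<exists>!c. c \<in> carrier_vec (k1 + k2) \<and> (\<forall>i\<in>{k1..<k1+k2}. c $ i \<in> dual_base) \<and> x = G\<^sup>T *\<^sub>v c"
      using gen x by (simp add: generator_matrix_def)
    ultimately show ?thesis
      by (metis (mono_tags, lifting))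
  qed
  show ?thesis
    unfolding generator_matrix_def
  proof (intro conjI)
    show "\<forall>i<k1 + k2. row ?H i \<in> permute_code m \<sigma> C"
      using row G(2) by (simp add: permute_code_def)
    show "\<forall>i<k1. row ?H i \<notin> u_vecs m"
      using row not_u by simp
    show "\<forall>i\<in>{k1..<k1 + k2}. row ?H i \<in> u_vecs m"
      using row G(4) s by (simp add: u_vecs_def)
  qed (use ex in \<open>auto simp: permute_code_def\<close>)
qed

text \<open>Brings the coordinates to be deleted to the end, where an embedding appends its
  columns.\<close>

lemma exists_permutes_image:
  assumes "J \<subseteq> {..<n}" "card J = n - m" "m \<le> n"
  shows "\<exists>\<pi>. \<pi> permutes {..<n} \<and> \<pi> ` {m..<n} = J"
proof -
  have fin: "finite J"
    using assms(1) finite_subset by blast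
  obtain f where f: "bij_betw f {m..<n} J"
    using fin assms finite_same_card_bij[of "{m..<n}" J] by auto
  obtain g where g: "bij_betw g {..<m} ({..<n} - J)"
    using fin assms finite_same_card_bij[of "{..<m}" "{..<n} - J"] by (auto simp: card_Diff_subset)
  define \<pi> where "\<pi> i = (if i < m then g i else if i < n then f i else i)" for i
  have "bij_betw \<pi> {..<m} ({..<n} - J)" "bij_betw \<pi> {m..<n} J"
    using bij_betw_cong[of "{..<m}" \<pi> g] bij_betw_cong[of "{m..<n}" \<pi> f] f g
    by (auto simp: \<pi>_def)
  moreover from bij_betw_combine[OF this] have "bij_betw \<pi> {..<n} {..<n}"
    using assms by (simp add: ivl_disj_un Un_absorb2 Int_commute)
  ultimately show ?thesis
    using \<open>m \<le> n\<close>
    by (intro exI[of _ \<pi>] conjI bij_imp_permutes) (simp_all add: \<pi>_def bij_betw_def)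
qed

section \<open>The self-orthogonal code as an embedding of its punctured code\<close>

text \<open>The difference \<open>d\<close> of two codewords with equal punctured parts lives on the
  deleted coordinates only. Its entry there at \<open>\<pi> j\<close> is its product with a codeword
  whose deleted part is the unit vector at \<open>\<pi> j\<close>, which is 0 by
  self-orthogonality.\<close>

lemma self_orthogonal_inj_on:
  fixes C :: "'a::comm_ring_1 dual vec set"
  assumes C: "linear_code n C" and so: "self_orthogonal C"
    and \<pi>: "\<pi> permutes {..<n}" and "m \<le> n" and J: "information_set (\<pi> ` {m..<n}) C"
  shows "inj_on (\<lambda>x. vec m (\<lambda>i. x $ \<pi> i)) C"
proof (rule inj_onI)
  fix x y assume xy: "x \<in> C" "y \<in> C" and eq: "vec m (\<lambda>i. x $ \<pi> i) = vec m (\<lambda>i. y $ \<pi> i)"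
  have carrier: "v \<in> carrier_vec n" if "v \<in> C" for v
    using C that by (auto simp: linear_code_iff)
  define d where "d = x + (- 1) \<cdot>\<^sub>v y"
  have "d \<in> C"
    using C xy by (simp add: d_def linear_code_iff)
  have d: "d $ i = x $ i - y $ i" if "i < n" for i
    using that carrier[OF xy(1)] carrier[OF xy(2)] by (simp add: d_def)
  have \<pi>_less: "\<pi> i < n" if "i < n" for i
    using permutes_in_image[OF \<pi>] that by simp
  have low: "d $ \<pi> i = 0" if "i < m" for i
    using that \<open>m \<le> n\<close> \<pi>_less arg_cong[OF eq, of "\<lambda>v. v $ i"] by (simp add: d)
  have high: "d $ \<pi> j = 0" if j: "j \<in> {m..<n}" for j
  proof -
    obtain z where z: "z \<in> C" "\<forall>i\<in>\<pi> ` {m..<n}. z $ i = (if i = \<pi> j then 1 else 0)"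
      using J[unfolded information_set_def, rule_format, of "\<lambda>i. if i = \<pi> j then 1 else 0"] by blast
    have "0 = (\<Sum>i<n. d $ i * z $ i)"
      using so \<open>d \<in> C\<close> z(1) carrier_vecD[OF carrier[OF z(1)]]
      by (auto simp: self_orthogonal_def scalar_prod_def atLeast0LessThan)
    also have "\<dots> = (\<Sum>i<n. d $ \<pi> i * z $ \<pi> i)"
      by (rule sum.permute[OF \<pi>, unfolded o_def])
    also have "\<dots> = (\<Sum>i<n. if i = j then d $ \<pi> i else 0)"
    proof (intro sum.cong refl)
      fix i assume i: "i \<in> {..<n}"
      show "d $ \<pi> i * z $ \<pi> i = (if i = j then d $ \<pi> i else 0)"
      proof (cases "i < m")
        case True
        then show ?thesis
          using low j by auto
      next
        case False
        then have "\<pi> i \<in> \<pi> ` {m..<n}" using i by simp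
        then show ?thesis
          using z(2) inj_eq[OF permutes_inj[OF \<pi>]] by auto
      qed
    qed
    finally show ?thesis
      using j by simp
  qed
  have "d $ i = 0" if "i < n" for i
  proof -
    obtain j where "i = \<pi> j"
      using permutes_surj[OF \<pi>] by (metis surjD)
    moreover have "j < n"
      using that \<open>i = \<pi> j\<close> permutes_in_image[OF \<pi>, of j] by simp
    ultimately show ?thesis
      using low high by (cases "j < m") auto
  qed
  then show "x = y"
    using d carrier[OF xy(1)] carrier[OF xy(2)] by (intro eq_vecI) auto
qed

text \<open>The permuted generator matrix of \<open>C\<close> is cut after column \<open>m\<close>.
  Its left block generates the punctured code with the same type, since puncturing is injective, and
  its right block serves as the appended matrix.\<close>

lemma so_embedding_permute_code:
  fixes C :: "'a::comm_ring_1 dual vec set"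
  assumes C: "linear_code n C" and so: "self_orthogonal C" and gen: "generator_matrix n k1 k2 C G"
    and \<pi>: "\<pi> permutes {..<n}" and "m \<le> n" and J: "information_set (\<pi> ` {m..<n}) C"
  shows "so_embedding m (permute_code m \<pi> C) n (permute_code n \<pi> C)"
proof -
  have \<pi>_n: "\<pi> ` {..<n} \<subseteq> {..<n}" "\<pi> ` {..<m} \<subseteq> {..<n}"
    using permutes_image[OF \<pi>] image_mono[of "{..<m}" "{..<n}" \<pi>] \<open>m \<le> n\<close> by simp_all
  \<comment> \<open>For \<open>m = n\<close> no coordinate is deleted, and the empty information set
    yields injectivity of the full permutation.\<close>
  have inj: "inj_on (\<lambda>x. vec m (\<lambda>i. x $ \<pi> i)) C" "inj_on (\<lambda>x. vec n (\<lambda>i. x $ \<pi> i)) C"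
    using self_orthogonal_inj_on[OF C so \<pi>, of m] self_orthogonal_inj_on[OF C so \<pi>, of n] \<open>m \<le> n\<close> J
      information_set_subset[OF J, of "{}"]
    by simp_all
  define H where "H = mat (k1 + k2) n (\<lambda>(i, j). G $$ (i, \<pi> j))"
  define G0 where "G0 = mat (k1 + k2) m (\<lambda>(i, j). G $$ (i, \<pi> j))"
  define B where "B = mat (k1 + k2) (n - m) (\<lambda>(i, j). G $$ (i, \<pi> (m + j)))"
  have H: "append_cols G0 B = H"
    using \<open>m \<le> n\<close> by (intro eq_matI) (auto simp: append_cols_def G0_def B_def H_def)
  have "permute_code n \<pi> C = code_generated_by_rows H"
    using code_generated_by_generator_matrix[OF linear_code_permute_code[OF C \<pi>_n(1)]
        generator_matrix_permute_code[OF C gen \<pi>_n(1) inj(2)]]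
    by (simp add: H_def)
  moreover have "generator_matrix m k1 k2 (permute_code m \<pi> C) G0"
    unfolding G0_def by (rule generator_matrix_permute_code[OF C gen \<pi>_n(2) inj(1)])
  moreover have "self_orthogonal (permute_code n \<pi> C)"
    unfolding self_orthogonal_def permute_code_def
  proof (clarify)
    fix x y assume xy: "x \<in> C" "y \<in> C"
    then have "y \<in> carrier_vec n"
      using C by (auto simp: linear_code_iff)
    have "vec n (\<lambda>i. x $ \<pi> i) \<bullet> vec n (\<lambda>i. y $ \<pi> i) = (\<Sum>i<n. x $ \<pi> i * y $ \<pi> i)"
      by (simp add: scalar_prod_def atLeast0LessThan)
    also have "\<dots> = (\<Sum>i<n. x $ i * y $ i)"
      by (rule sum.permute[OF \<pi>, unfolded o_def, symmetric])
    also have "\<dots> = x \<bullet> y"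
      using \<open>y \<in> carrier_vec n\<close> by (simp add: scalar_prod_def atLeast0LessThan)
    finally show "vec n (\<lambda>i. x $ \<pi> i) \<bullet> vec n (\<lambda>i. y $ \<pi> i) = 0"
      using so xy by (simp add: self_orthogonal_def)
  qed
  moreover have "B \<in> carrier_mat (k1 + k2) (n - m)" "n = m + (n - m)"
    using \<open>m \<le> n\<close> by (simp_all add: B_def)
  ultimately show ?thesis
    unfolding so_embedding_def H[symmetric] by blast
qed

section \<open>The lower bound on the length of an embedding\<close>

text \<open>A combination of the rows of [G | B] is the concatenation of the combinations of the two
  blocks with the same coefficients, so its products split. This ties the Gram matrix of the
  appended parts to that of the embedded code.\<close>

lemma self_orthogonal_append_colsD:
  fixes G :: "'a::comm_ring_1 dual mat"
  assumes G: "G \<in> carrier_mat k n" and B: "B \<in> carrier_mat k l"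
    and so: "self_orthogonal (code_generated_by_rows (append_cols G B))"
    and c: "c \<in> carrier_vec k" "d \<in> carrier_vec k"
  shows "(G\<^sup>T *\<^sub>v c) \<bullet> (G\<^sup>T *\<^sub>v d) + (B\<^sup>T *\<^sub>v c) \<bullet> (B\<^sup>T *\<^sub>v d) = 0"
proof -
  have A: "append_cols G B \<in> carrier_mat k (n + l)"
    using G B by (auto simp: append_cols_def)
  have row: "row (append_cols G B) i = row G i @\<^sub>v row B i" if "i < k" for i
    using that G B by (auto simp: append_cols_def)
  have mem: "(append_cols G B)\<^sup>T *\<^sub>v v \<in> code_generated_by_rows (append_cols G B)"
    and split: "(append_cols G B)\<^sup>T *\<^sub>v v = (G\<^sup>T *\<^sub>v v) @\<^sub>v (B\<^sup>T *\<^sub>v v)" if v: "v \<in> carrier_vec k" for v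
  proof -
    show "(append_cols G B)\<^sup>T *\<^sub>v v \<in> code_generated_by_rows (append_cols G B)"
      using A v linear_code_generated[where G = "append_cols G B"]
      by (intro linear_code_transpose_mult_vec[where n = "n + l" and k = k]) auto
    show "(append_cols G B)\<^sup>T *\<^sub>v v = (G\<^sup>T *\<^sub>v v) @\<^sub>v (B\<^sup>T *\<^sub>v v)"
      unfolding transpose_mult_vec_eq[OF G v] transpose_mult_vec_eq[OF B v]
        transpose_mult_vec_eq[OF A v]
      using G B by (auto simp: row intro!: eq_vecI sum.cong)
  qed
  have "((G\<^sup>T *\<^sub>v c) @\<^sub>v (B\<^sup>T *\<^sub>v c)) \<bullet> ((G\<^sup>T *\<^sub>v d) @\<^sub>v (B\<^sup>T *\<^sub>v d)) = 0"
    using so mem[OF c(1)] mem[OF c(2)] split[OF c(1)] split[OF c(2)]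
    by (simp add: self_orthogonal_def)
  then show ?thesis
    using G B by (subst (asm) scalar_prod_append[of _ n _ l]) (auto intro!: carrier_vecI)
qed

lemma so_embedding_length_ge:
  fixes C :: "'a::{field, finite} dual vec set"
  assumes C: "linear_code n C" and so: "self_orthogonal C"
    and \<pi>: "\<pi> permutes {..<n}" and "m \<le> n" and J: "information_set (\<pi> ` {m..<n}) C"
    and emb: "so_embedding m (permute_code m \<pi> C) n' E"
  shows "n \<le> n'"
proof -
  from emb obtain k1 k2 l G B where gen: "generator_matrix m k1 k2 (permute_code m \<pi> C) G"
    and B: "B \<in> carrier_mat (k1 + k2) l" and n': "n' = m + l"
    and so': "self_orthogonal (code_generated_by_rows (append_cols G B))"
    unfolding so_embedding_def by blast
  have G: "G \<in> carrier_mat (k1 + k2) m"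
    using gen by (simp add: generator_matrix_def)
  \<comment> \<open>The codeword for \<open>i\<close> has the i-th unit vector as its deleted
    part.\<close>
  have "\<exists>x\<in>C. \<forall>j\<in>{m..<n}. x $ \<pi> j = (if j = m + i then 1 else 0)" for i
    using J[unfolded information_set_def, rule_format, of "\<lambda>j. if j = \<pi> (m + i) then 1 else 0"]
      inj_eq[OF permutes_inj[OF \<pi>]] by auto
  then obtain x where x: "\<And>i. x i \<in> C"
    "\<And>i j. j \<in> {m..<n} \<Longrightarrow> x i $ \<pi> j = (if j = m + i then 1 else 0)"
    by metis
  let ?y = "\<lambda>i. vec m (\<lambda>j. x i $ \<pi> j)"
  \<comment> \<open>\<open>G\<close> belongs to the arbitrary given embedding; the punctured
    codewords are expressed through its rows so that \<open>B\<close> can be applied to the same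
    coefficients.\<close>
  have "\<exists>c. c \<in> carrier_vec (k1 + k2) \<and> ?y i = G\<^sup>T *\<^sub>v c" for i
    using gen x(1)[of i] unfolding generator_matrix_def permute_code_def by blast
  then obtain c where c: "\<And>i. c i \<in> carrier_vec (k1 + k2)" "\<And>i. ?y i = G\<^sup>T *\<^sub>v c i"
    by metis
  have gram: "(B\<^sup>T *\<^sub>v c i) \<bullet> (B\<^sup>T *\<^sub>v c j) = (if i = j then 1 else 0)" if i: "i < n - m" and j: "j < n - m" for i j
  proof -
    have "x j \<in> carrier_vec n"
      using C x(1) by (auto simp: linear_code_iff)
    then have "dim_vec (x j) = n" by simp
    then have "0 = (\<Sum>t<n. x i $ t * x j $ t)"
      using so x(1)[of i] x(1)[of j] by (auto simp: self_orthogonal_def scalar_prod_def atLeast0LessThan)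
    also have "\<dots> = (\<Sum>t<n. x i $ \<pi> t * x j $ \<pi> t)"
      by (rule sum.permute[OF \<pi>, unfolded o_def])
    \<comment> \<open>Kept and deleted coordinates are separated; the deleted ones contribute the
      product of two unit vectors.\<close>
    also have "\<dots> = (\<Sum>t<m. x i $ \<pi> t * x j $ \<pi> t) + (\<Sum>t\<in>{m..<n}. x i $ \<pi> t * x j $ \<pi> t)"
      using \<open>m \<le> n\<close> by (subst sum.union_disjoint[symmetric]) (auto intro!: sum.cong)
    also have "(\<Sum>t<m. x i $ \<pi> t * x j $ \<pi> t) = ?y i \<bullet> ?y j"
      by (simp add: scalar_prod_def atLeast0LessThan)
    also have "(\<Sum>t\<in>{m..<n}. x i $ \<pi> t * x j $ \<pi> t) =
        (\<Sum>t\<in>{m..<n}. if t = m + i then (if i = j then 1 else 0) else 0)"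
      by (intro sum.cong) (auto simp: x(2))
    also have "\<dots> = (if i = j then 1 else 0)"
      using i j by auto
    finally have deleted: "0 = ?y i \<bullet> ?y j + (if i = j then 1 else 0)" .
    have "?y i \<bullet> ?y j + (B\<^sup>T *\<^sub>v c i) \<bullet> (B\<^sup>T *\<^sub>v c j) = 0"
      using self_orthogonal_append_colsD[OF G B so' c(1)[of i] c(1)[of j]] by (simp only: c(2))
    \<comment> \<open>The appended parts and the deleted parts complete the same product of kept
      parts to 0, so the two Gram matrices agree.\<close>
    from add_left_imp_eq[OF trans[OF this deleted]] show ?thesis .
  qed
  have "n - m \<le> l"
  proof (rule orthonormal_vecs_le_dim)
    show "B\<^sup>T *\<^sub>v c i \<in> carrier_vec l" for i
      using B by (intro carrier_vecI) simp
  qed (rule gram)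
  then show ?thesis
    using n' by simp
qed

section \<open>Existence of the punctured code with the required shortest embedding\<close>

theorem theorem5p1:
  fixes C :: "'a::{field, finite} dual vec set" and n k1 k2 n0 :: nat
  assumes "linear_code n C"
    and "self_orthogonal C"
    and "code_type n C k1 k2"
    and "k1 > 0"
    and "n - k1 \<le> n0"
    and "n0 < n"
  shows "\<exists>C0 \<pi>. linear_code n0 C0 \<and> \<pi> permutes {..<n} \<and>
           shortest_so_embedding n0 C0 n (permute_code n \<pi> C)"
proof -
  obtain G where G: "generator_matrix n k1 k2 C G"
    using assms(3) by (auto simp: code_type_def)
  have "n - n0 \<le> k1"
    using assms(5) by simp
  then obtain J where J: "J \<subseteq> {..<n}" "card J = n - n0" "information_set J C"
    using information_set_exists[OF assms(1) G] by blast
  obtain \<pi> where \<pi>: "\<pi> permutes {..<n}" "\<pi> ` {n0..<n} = J"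
    using exists_permutes_image[OF J(1,2)] assms(6) by auto
  have "\<pi> ` {..<n0} \<subseteq> {..<n}"
    using permutes_image[OF \<pi>(1)] image_mono[of "{..<n0}" "{..<n}" \<pi>] assms(6) by simp
  \<comment> \<open>The witness is \<open>C\<close> with the coordinates in \<open>J\<close>
    deleted, as \<open>\<pi>\<close> maps the last n - n0 positions onto \<open>J\<close>.\<close>
  then have "linear_code n0 (permute_code n0 \<pi> C)"
    by (rule linear_code_permute_code[OF assms(1)])
  moreover have "shortest_so_embedding n0 (permute_code n0 \<pi> C) n (permute_code n \<pi> C)"
    unfolding shortest_so_embedding_def
  proof (intro conjI allI impI)
    have J': "information_set (\<pi> ` {n0..<n}) C"
      using J(3) \<pi>(2) by simp
    show "so_embedding n0 (permute_code n0 \<pi> C) n (permute_code n \<pi> C)"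
      by (rule so_embedding_permute_code[OF assms(1,2) G \<pi>(1) less_imp_le[OF assms(6)] J'])
    show "n \<le> m'" if "so_embedding n0 (permute_code n0 \<pi> C) m' E'" for m' E'
      by (rule so_embedding_length_ge[OF assms(1,2) \<pi>(1) less_imp_le[OF assms(6)] J' that])
  qed
  ultimately show ?thesis
    using \<pi>(1) by blast
qed

end
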